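(* $\gamma_I(P(n,1))=\gamma_{r2}(P(n,1))$.
   Context: $P(n,k)$ (with $n\ge 3$, $1\le k<n/2$) denotes the generalized Petersen graph: the 3-regular simple graph on the $2n$ vertices $v_0,v_1,\dots,v_{2n-1}$ (subscripts read modulo $2n$) with edges $v_{2i}v_{2i+2}$, $v_{2i}v_{2i+1}$ and $v_{2i+1}v_{2i+1+2k}$ for $0\le i\le n-1$; thus $P(n,1)$ is considered for all integers $n\ge 3$. For a graph $G=(V,E)$, an Italian dominating function (IDF) of $G$ is a function $f:V\to\{0,1,2\}$ such that every $v\in V$ with $f(v)=0$ satisfies $\sum_{u\in N(v)}f(u)\ge 2$, where $N(v)$ is the open neighborhood of $v$. Its weight is $w(f)=\sum_{v\in V}f(v)$, and the Italian domination number is $\gamma_I(G)=\min_f w(f)$ over all IDFs $f$ of $G$. A 2-rainbow dominating function of $G$ is a function $g:V\to\{\emptyset,\{1\},\{2\},\{1,2\}\}$ such that every $v\in V$ with $g(v)=\emptyset$ satisfies $\bigcup_{u\in N(v)}g(u)=\{1,2\}$; its weight is $\sum_{v\in V}|g(v)|$, and the 2-rainbow domination number $\gamma_{r2}(G)$ is the minimum weight of a 2-rainbow dominating function of $G$. *)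

theory Defs
  imports Main "Graph_Theory.Pair_Digraph"
begin

text \<open>An undirected simple graph is a symmetric loop-free pair digraph (locale \<open>pair_graph\<close>);
  an edge \<open>uv\<close> is represented by its two arcs \<open>(u, v)\<close> and \<open>(v, u)\<close>.\<close>

definition gen_petersen_edges :: "nat \<Rightarrow> nat \<Rightarrow> (nat \<times> nat) set" where
  "gen_petersen_edges n k =
     {(2 * i, (2 * i + 2) mod (2 * n)) | i. i < n} \<union>
     {(2 * i, 2 * i + 1) | i. i < n} \<union>
     {(2 * i + 1, (2 * i + 1 + 2 * k) mod (2 * n)) | i. i < n}"

definition gen_petersen :: "nat \<Rightarrow> nat \<Rightarrow> nat pair_pre_digraph" where
  "gen_petersen n k =
     \<lparr> pverts = {..<2 * n},
       parcs = gen_petersen_edges n k \<union> (gen_petersen_edges n k)\<inverse> \<rparr>"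

definition open_nbhd :: "'a pair_pre_digraph \<Rightarrow> 'a \<Rightarrow> 'a set" where
  "open_nbhd G v = {u. (v, u) \<in> parcs G}"

text \<open>Values of functions outside the vertex set are unconstrained; they affect neither the
  domination conditions nor the weights.\<close>

definition italian_dominating :: "'a pair_pre_digraph \<Rightarrow> ('a \<Rightarrow> nat) \<Rightarrow> bool" where
  "italian_dominating G f \<longleftrightarrow>
     f \<in> pverts G \<rightarrow> {0, 1, 2} \<and>
     (\<forall>v \<in> pverts G. f v = 0 \<longrightarrow> (\<Sum>u \<in> open_nbhd G v. f u) \<ge> 2)"

definition italian_weight :: "'a pair_pre_digraph \<Rightarrow> ('a \<Rightarrow> nat) \<Rightarrow> nat" where
  "italian_weight G f = (\<Sum>v \<in> pverts G. f v)"

definition italian_domination_number :: "'a pair_pre_digraph \<Rightarrow> nat" where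
  "italian_domination_number G = (LEAST w. \<exists>f. italian_dominating G f \<and> italian_weight G f = w)"

definition rainbow2_dominating :: "'a pair_pre_digraph \<Rightarrow> ('a \<Rightarrow> nat set) \<Rightarrow> bool" where
  "rainbow2_dominating G g \<longleftrightarrow>
     g \<in> pverts G \<rightarrow> {{}, {1}, {2}, {1, 2}} \<and>
     (\<forall>v \<in> pverts G. g v = {} \<longrightarrow> (\<Union>u \<in> open_nbhd G v. g u) = {1, 2})"

definition rainbow2_weight :: "'a pair_pre_digraph \<Rightarrow> ('a \<Rightarrow> nat set) \<Rightarrow> nat" where
  "rainbow2_weight G g = (\<Sum>v \<in> pverts G. card (g v))"

definition rainbow2_domination_number :: "'a pair_pre_digraph \<Rightarrow> nat" where
  "rainbow2_domination_number G =
     (LEAST w. \<exists>g. rainbow2_dominating G g \<and> rainbow2_weight G g = w)"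

text \<open>Both minima are attained, so \<open>LEAST\<close> never ranges over an empty set of weights.\<close>

lemma italian_domination_number_attained:
  "\<exists>f. italian_dominating G f \<and> italian_weight G f = italian_domination_number G"
proof -
  have "italian_dominating G (\<lambda>_. 1)"
    by (simp add: italian_dominating_def)
  then have "\<exists>w f. italian_dominating G f \<and> italian_weight G f = w"
    by blast
  then show ?thesis
    unfolding italian_domination_number_def by (rule LeastI_ex)
qed

lemma rainbow2_domination_number_attained:
  "\<exists>g. rainbow2_dominating G g \<and> rainbow2_weight G g = rainbow2_domination_number G"
proof -
  have "rainbow2_dominating G (\<lambda>_. {1})"
    by (simp add: rainbow2_dominating_def)
  then have "\<exists>w g. rainbow2_dominating G g \<and> rainbow2_weight G g = w"
    by blast
  then show ?thesis
    unfolding rainbow2_domination_number_def by (rule LeastI_ex)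
qed

lemma pair_graph_gen_petersen:
  assumes "n \<ge> 3" "1 \<le> k" "2 * k < n"
  shows "pair_graph (gen_petersen n k)"
proof -
  let ?G = "gen_petersen n k" and ?E = "gen_petersen_edges n k"
  have verts: "a < 2 * n \<and> b < 2 * n" if "(a, b) \<in> ?E" for a b
    using that assms by (auto simp: gen_petersen_edges_def)
  have shift: "(x + d) mod (2 * n) \<noteq> x" if "x < 2 * n" "0 < d" "d < 2 * n" for x d
  proof (cases "x + d < 2 * n")
    case False
    then have "(x + d) mod (2 * n) = x + d - 2 * n"
      using that by (simp add: le_mod_geq)
    then show ?thesis using that False by linarith
  qed (use that in simp)
  have noloop: "a \<noteq> b" if ab: "(a, b) \<in> ?E" for a b
  proof -
    consider i where "i < n" "a = 2 * i" "b = (2 * i + 2) mod (2 * n)"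
      | i where "i < n" "a = 2 * i" "b = 2 * i + 1"
      | i where "i < n" "a = 2 * i + 1" "b = (2 * i + 1 + 2 * k) mod (2 * n)"
      using ab unfolding gen_petersen_edges_def by blast
    then show ?thesis
    proof cases
      case 1
      show ?thesis using shift[of "2 * i" 2] 1 assms by linarith
    next
      case 2
      then show ?thesis by linarith
    next
      case 3
      show ?thesis using shift[of "2 * i + 1" "2 * k"] 3 assms by linarith
    qed
  qed
  have sub: "parcs ?G \<subseteq> {..<2 * n} \<times> {..<2 * n}"
    using verts by (auto simp: gen_petersen_def)
  then have "finite (parcs ?G)"
    by (rule finite_subset) simp
  moreover have "fst e \<noteq> snd e" if "e \<in> parcs ?G" for e
    using that noloop[of "fst e" "snd e"] noloop[of "snd e" "fst e"]
    by (cases e) (auto simp: gen_petersen_def)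
  ultimately show ?thesis
    using sub by unfold_locales (auto simp: gen_petersen_def symmetric_def sym_def)
qed

lemma gen_petersen_3_regular:
  assumes "n \<ge> 3" "1 \<le> k" "2 * k < n" "v \<in> pverts (gen_petersen n k)"
  shows "card (open_nbhd (gen_petersen n k) v) = 3"
proof -
  have v: "v < 2 * n"
    using assms(4) by (simp add: gen_petersen_def)
  have dbl: "(2 * i + 2 * d) mod (2 * n) = 2 * ((i + d) mod n)"
    "(2 * i + 1 + 2 * d) mod (2 * n) = 2 * ((i + d) mod n) + 1" for i d :: nat
  proof -
    show *: "(2 * i + 2 * d) mod (2 * n) = 2 * ((i + d) mod n)"
      by (metis distrib_left mult_mod_right)
    have "2 * ((i + d) mod n) + 1 < 2 * n"
      using assms(1) mod_less_divisor[of n "i + d"] by linarith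
    moreover have "(2 * i + 1 + 2 * d) mod (2 * n) = ((2 * i + 2 * d) mod (2 * n) + 1) mod (2 * n)"
      by (simp add: mod_Suc_eq)
    ultimately show "(2 * i + 1 + 2 * d) mod (2 * n) = 2 * ((i + d) mod n) + 1"
      unfolding * by (simp only: mod_less)
  qed
  have wrap: "(x + y) mod n = (if x + y < n then x + y else x + y - n)"
    if "x < n" "y < n" for x y
    using that by (simp add: le_mod_geq)
  have pred: "i < n \<and> (i + d) mod n = j \<longleftrightarrow> i = (j + (n - d)) mod n"
    if d: "j < n" "0 < d" "d < n" for i j d
  proof -
    have "(j + (n - d)) mod n < n"
      using d by simp
    moreover have "i < n \<Longrightarrow> (i + d) mod n = j \<longleftrightarrow> i = (j + (n - d)) mod n"
      using d wrap[of i d] wrap[of j "n - d"] by (simp split: if_splits) linarith+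
    ultimately show ?thesis by blast
  qed
  have neq: "(j + (n - d)) mod n \<noteq> (j + d) mod n"
    if "j < n" "0 < d" "2 * d < n" for j d
  proof -
    have "d < n" "n - d < n"
      using that by linarith+
    then show ?thesis
      using that wrap[of j d] wrap[of j "n - d"] by (simp split: if_splits)
  qed
  have edges: "gen_petersen_edges n k = {(2 * i, 2 * ((i + 1) mod n)) | i. i < n} \<union>
      {(2 * i, 2 * i + 1) | i. i < n} \<union> {(2 * i + 1, 2 * ((i + k) mod n) + 1) | i. i < n}"
    unfolding gen_petersen_edges_def using dbl(1)[of _ 1] dbl(2)[of _ k] by simp
  have parity: "2 * x \<noteq> Suc (2 * y)" "Suc (2 * y) \<noteq> 2 * x" for x y :: nat
    by presburger+
  show ?thesis
  proof (cases "even v")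
    case True
    then obtain j where j: "v = 2 * j" "j < n"
      using v by (auto elim: evenE)
    have "open_nbhd (gen_petersen n k) v =
        {2 * ((j + 1) mod n), 2 * j + 1} \<union> (\<lambda>i. 2 * i) ` {i. i < n \<and> (i + 1) mod n = j}"
      unfolding open_nbhd_def gen_petersen_def edges using j by (auto simp: parity)
    also have "{i. i < n \<and> (i + 1) mod n = j} = {(j + (n - 1)) mod n}"
      using pred[OF j(2), of 1] assms(1) by auto
    finally have N: "open_nbhd (gen_petersen n k) v =
        {2 * ((j + 1) mod n), 2 * j + 1, 2 * ((j + (n - 1)) mod n)}"
      by auto
    have "(j + (n - 1)) mod n \<noteq> (j + 1) mod n"
      using neq[OF j(2), of 1] assms(1) by simp
    then show ?thesis
      unfolding N by (auto simp: card_insert_if parity)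
  next
    case False
    then obtain j where j: "v = 2 * j + 1" "j < n"
      using v by (auto elim: oddE)
    have "open_nbhd (gen_petersen n k) v =
        {2 * ((j + k) mod n) + 1, 2 * j} \<union> (\<lambda>i. 2 * i + 1) ` {i. i < n \<and> (i + k) mod n = j}"
      unfolding open_nbhd_def gen_petersen_def edges using j by (auto simp: parity)
    also have "{i. i < n \<and> (i + k) mod n = j} = {(j + (n - k)) mod n}"
      using pred[OF j(2), of k] assms by auto
    finally have N: "open_nbhd (gen_petersen n k) v =
        {2 * ((j + k) mod n) + 1, 2 * j, 2 * ((j + (n - k)) mod n) + 1}"
      by auto
    have "(j + (n - k)) mod n \<noteq> (j + k) mod n"
      using neq[OF j(2), of k] assms by simp
    then show ?thesis
      unfolding N by (auto simp: card_insert_if parity)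
  qed
qed

end

theory Submission
  imports Defs "HOL-Number_Theory.Cong"
begin

text \<open>Both numbers are equal to \<open>n\<close>. The graph \<open>P(n,1)\<close> is the prism over an \<open>n\<close>-cycle; its
  \<open>i\<close>-th column consists of the adjacent vertices \<open>2i\<close> and \<open>2i+1\<close>. The equality follows from the
  cycle of inequalities \<open>n \<le> \<gamma>\<^sub>I \<le> \<gamma>\<^sub>r\<^sub>2 \<le> n\<close>.

  For \<open>n \<le> \<gamma>\<^sub>I\<close> (lemma \<open>italian_weight_prism_ge\<close>) the weight is redistributed between
  columns: a column of weight \<open>a \<ge> 1\<close> keeps \<open>1\<close> and passes half of the surplus
  \<open>a - 1\<close> to each of the two neighbouring columns. Both vertices of a column of weight \<open>0\<close> rely on the
  neighbouring columns alone, whose weights therefore add up to at least \<open>4\<close>, so that the empty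
  column receives at least \<open>1\<close>. Afterwards every column has at least \<open>1\<close>.

  The inequality \<open>\<gamma>\<^sub>I \<le> \<gamma>\<^sub>r\<^sub>2\<close> holds in every graph with finite neighbourhoods, since the
  cardinalities of the colour sets form an Italian dominating function. Finally,
  \<open>\<gamma>\<^sub>r\<^sub>2 \<le> n\<close> because one colour per column suffices: colour \<open>1\<close> on the outer cycle
  in the even columns and colour \<open>2\<close> on the inner cycle in the odd columns.\<close>

section \<open>Italian and 2-rainbow domination\<close>

lemma italian_domination_number_le:
  "italian_dominating G f \<Longrightarrow> italian_domination_number G \<le> italian_weight G f"
  unfolding italian_domination_number_def by (rule Least_le) blast

lemma rainbow2_domination_number_le:
  "rainbow2_dominating G g \<Longrightarrow> rainbow2_domination_number G \<le> rainbow2_weight G g"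
  unfolding rainbow2_domination_number_def by (rule Least_le) blast

lemma italian_dominating_card:
  assumes fin: "\<And>v. v \<in> pverts G \<Longrightarrow> finite (open_nbhd G v)"
    and g: "rainbow2_dominating G g"
  shows "italian_dominating G (\<lambda>v. card (g v))"
  unfolding italian_dominating_def
proof (intro conjI ballI impI)
  have "g v \<in> {{}, {1}, {2}, {1, 2}}" if "v \<in> pverts G" for v
    using g that unfolding rainbow2_dominating_def by blast
  then have cols: "finite (g v)" "card (g v) \<in> {0, 1, 2}" if "v \<in> pverts G" for v
    using that by fastforce+
  then show "(\<lambda>v. card (g v)) \<in> pverts G \<rightarrow> {0, 1, 2}"
    by blast
  fix v assume v: "v \<in> pverts G" "card (g v) = 0"
  then have "g v = {}"
    using cols by simp
  then have "(\<Union>u \<in> open_nbhd G v. g u) = {1, 2}"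
    using g v unfolding rainbow2_dominating_def by blast
  then show "(\<Sum>u \<in> open_nbhd G v. card (g u)) \<ge> 2"
    using card_UN_le[OF fin[OF v(1)], of g] by simp
qed

lemma italian_le_rainbow2_domination_number:
  assumes "\<And>v. v \<in> pverts G \<Longrightarrow> finite (open_nbhd G v)"
  shows "italian_domination_number G \<le> rainbow2_domination_number G"
proof -
  obtain g where g: "rainbow2_dominating G g" "rainbow2_weight G g = rainbow2_domination_number G"
    using rainbow2_domination_number_attained by blast
  show ?thesis
    using italian_domination_number_le[OF italian_dominating_card[OF assms g(1)]] g(2)
    by (simp add: italian_weight_def rainbow2_weight_def)
qed

section \<open>The prism\<close>

lemma pverts_gen_petersen [simp]: "pverts (gen_petersen n k) = {..<2 * n}"
  by (simp add: gen_petersen_def)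

lemma sum_columns: "(\<Sum>v<2 * n. f v) = (\<Sum>i<n. f (2 * i) + f (2 * i + 1))"
  for f :: "nat \<Rightarrow> nat"
  by (induction n) simp_all

lemma open_nbhd_prism:
  assumes n: "n > 0" and i: "i < n"
  shows "open_nbhd (gen_petersen n 1) (2 * i) =
      {2 * ((i + 1) mod n), 2 * ((i + (n - 1)) mod n), 2 * i + 1}" (is ?outer)
    and "open_nbhd (gen_petersen n 1) (2 * i + 1) =
      {2 * ((i + 1) mod n) + 1, 2 * ((i + (n - 1)) mod n) + 1, 2 * i}" (is ?inner)
proof -
  have outer_step: "(2 * j + 2) mod (2 * n) = 2 * ((j + 1) mod n)" for j
    by (metis distrib_left mult_mod_right mult.right_neutral)
  have inner_step: "(2 * j + 1 + 2 * 1) mod (2 * n) = 2 * ((j + 1) mod n) + 1" for j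
  proof -
    have "2 * ((j + 1) mod n) + 1 < 2 * n"
      using n mod_less_divisor[of n "j + 1"] by linarith
    moreover have "(2 * j + 1 + 2 * 1) mod (2 * n) = ((2 * j + 2) mod (2 * n) + 1) mod (2 * n)"
      by (simp add: mod_Suc_eq)
    ultimately show ?thesis
      unfolding outer_step by (simp only: mod_less)
  qed
  have edges: "gen_petersen_edges n 1 = {(2 * j, 2 * ((j + 1) mod n)) | j. j < n} \<union>
      {(2 * j, 2 * j + 1) | j. j < n} \<union> {(2 * j + 1, 2 * ((j + 1) mod n) + 1) | j. j < n}"
    unfolding gen_petersen_edges_def outer_step inner_step ..
  have pred: "j < n \<and> i = (j + 1) mod n \<longleftrightarrow> j = (i + (n - 1)) mod n" for j
  proof (cases "j + 1 < n")
    case True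
    then show ?thesis
      using i by (cases "i = 0") (auto simp: le_mod_geq)
  next
    case False
    then show ?thesis
      using n i by (cases "i = 0"; cases "j + 1 = n") (auto simp: le_mod_geq)
  qed
  have parity: "2 * x \<noteq> Suc (2 * y)" "Suc (2 * y) \<noteq> 2 * x" for x y :: nat
    by presburger+
  have "open_nbhd (gen_petersen n 1) (2 * i) =
      {2 * ((i + 1) mod n), 2 * i + 1} \<union> (\<lambda>j. 2 * j) ` {j. j < n \<and> i = (j + 1) mod n}"
    unfolding open_nbhd_def gen_petersen_def edges using i by (auto simp: parity)
  then show ?outer
    unfolding pred by auto
  have "open_nbhd (gen_petersen n 1) (2 * i + 1) =
      {2 * ((i + 1) mod n) + 1, 2 * i} \<union> (\<lambda>j. 2 * j + 1) ` {j. j < n \<and> i = (j + 1) mod n}"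
    unfolding open_nbhd_def gen_petersen_def edges using i by (auto simp: parity)
  then show ?inner
    unfolding pred by auto
qed

lemma sum_rotate:
  fixes h :: "nat \<Rightarrow> nat"
  shows "(\<Sum>i<n. h ((i + d) mod n)) = (\<Sum>i<n. h i)"
proof (cases "n = 0")
  case False
  have "inj_on (\<lambda>i. (i + d) mod n) {..<n}"
  proof (rule inj_onI)
    fix x y assume xy: "x \<in> {..<n}" "y \<in> {..<n}" "(x + d) mod n = (y + d) mod n"
    then have "[x + d = y + d] (mod n)"
      by (simp add: cong_def)
    then have "[x = y] (mod n)"
      by (simp only: cong_add_rcancel_nat)
    then show "x = y"
      using xy by (simp add: cong_def)
  qed
  moreover have "(\<lambda>i. (i + d) mod n) ` {..<n} \<subseteq> {..<n}"
    using False by auto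
  ultimately have "bij_betw (\<lambda>i. (i + d) mod n) {..<n} {..<n}"
    by (simp add: bij_betw_def endo_inj_surj)
  then show ?thesis
    by (rule sum.reindex_bij_betw)
qed simp

lemma italian_weight_prism_ge:
  assumes n: "n > 0" and f: "italian_dominating (gen_petersen n 1) f"
  shows "n \<le> italian_weight (gen_petersen n 1) f"
proof -
  define a where "a i = f (2 * i) + f (2 * i + 1)" for i
  \<comment> \<open>In truncated subtraction, so that an empty column has surplus \<open>0\<close> rather than \<open>-1\<close>.\<close>
  define surplus where "surplus i = a i - 1" for i
  have redistributed: "2 * surplus i + 2 \<le>
      2 * a i + (surplus ((i + 1) mod n) + surplus ((i + (n - 1)) mod n))" if i: "i < n" for i
  proof (cases "a i = 0")
    case True
    have dom: "2 \<le> (\<Sum>u \<in> open_nbhd (gen_petersen n 1) v. f u)" if "v < 2 * n" "f v = 0" for v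
      using f that unfolding italian_dominating_def by simp
    have sum3: "(\<Sum>u \<in> {x, y, z}. f u) \<le> f x + f y + f z" for x y z
      by (simp add: sum.insert_if)
    have zero: "f (2 * i) = 0" "f (2 * i + 1) = 0"
      using True by (simp_all add: a_def)
    have "2 \<le> f (2 * ((i + 1) mod n)) + f (2 * ((i + (n - 1)) mod n))"
      using dom[of "2 * i"] i zero open_nbhd_prism(1)[OF n i]
        sum3[of "2 * ((i + 1) mod n)" "2 * ((i + (n - 1)) mod n)" "2 * i + 1"]
      by simp
    moreover have "2 \<le> f (2 * ((i + 1) mod n) + 1) + f (2 * ((i + (n - 1)) mod n) + 1)"
      using dom[of "2 * i + 1"] i zero open_nbhd_prism(2)[OF n i]
        sum3[of "2 * ((i + 1) mod n) + 1" "2 * ((i + (n - 1)) mod n) + 1" "2 * i"]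
      by simp
    ultimately have "4 \<le> a ((i + 1) mod n) + a ((i + (n - 1)) mod n)"
      by (simp add: a_def)
    then show ?thesis
      using True by (simp add: surplus_def)
  next
    case False
    then show ?thesis
      by (simp add: surplus_def)
  qed
  have "(\<Sum>i<n. 2 * surplus i + 2) \<le>
      (\<Sum>i<n. 2 * a i + (surplus ((i + 1) mod n) + surplus ((i + (n - 1)) mod n)))"
    using redistributed by (intro sum_mono) simp
  then have "2 * (\<Sum>i<n. surplus i) + 2 * n \<le> 2 * (\<Sum>i<n. a i) + 2 * (\<Sum>i<n. surplus i)"
    unfolding sum.distrib sum_rotate sum_distrib_left[symmetric] by simp
  then have "n \<le> (\<Sum>i<n. a i)"
    by linarith
  then show ?thesis
    by (simp add: italian_weight_def sum_columns a_def)
qed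

text \<open>Residues modulo \<open>4\<close> encode column parity and cycle together: \<open>0\<close> is the outer vertex of
  an even column and \<open>3\<close> the inner vertex of an odd one.\<close>

definition alternating_colouring :: "nat \<Rightarrow> nat set" where
  "alternating_colouring v = (if v mod 4 = 0 then {1} else if v mod 4 = 3 then {2} else {})"

text \<open>An uncoloured vertex sees one colour inside its own column and the other in a neighbouring
  column of opposite parity. For odd \<open>n\<close> the first and the last column are adjacent and both even,
  but each of them still has its other neighbour.\<close>

lemma alternating_colouring_dominating:
  assumes "n \<ge> 2"
  shows "rainbow2_dominating (gen_petersen n 1) alternating_colouring"
  unfolding rainbow2_dominating_def
proof (intro conjI ballI impI)
  let ?G = "gen_petersen n 1" and ?c = alternating_colouring
  have n: "n > 0"
    using assms by simp
  show "?c \<in> pverts ?G \<rightarrow> {{}, {1}, {2}, {1, 2}}"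
    by (auto simp: alternating_colouring_def)
  fix v assume v: "v \<in> pverts ?G" "?c v = {}"
  have "\<exists>x \<in> open_nbhd ?G v. \<exists>y \<in> open_nbhd ?G v. x mod 4 = 0 \<and> y mod 4 = 3"
  proof (cases "even v")
    case True
    then obtain i where i: "v = 2 * i" "i < n"
      using v(1) by (auto elim: evenE)
    have "v mod 4 \<noteq> 0"
      using v(2) by (simp add: alternating_colouring_def split: if_splits)
    then have odd: "odd i"
      using i by presburger
    then obtain j where j: "i = 2 * j + 1"
      by (elim oddE)
    have "i + (n - 1) = 2 * j + n"
      using j assms by simp
    then have prev: "(i + (n - 1)) mod n = 2 * j"
      using i(2) j by (simp only: mod_add_self2) simp
    have "(2 * (2 * j)) mod 4 = 0" "(2 * i + 1) mod 4 = 3"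
      unfolding j by presburger+
    moreover have "2 * (2 * j) \<in> open_nbhd ?G v" "2 * i + 1 \<in> open_nbhd ?G v"
      unfolding i(1) open_nbhd_prism(1)[OF n i(2)] prev by blast+
    ultimately show ?thesis
      by metis
  next
    case False
    then obtain i where i: "v = 2 * i + 1" "i < n"
      using v(1) by (auto elim: oddE)
    have "v mod 4 \<noteq> 3"
      using v(2) by (simp add: alternating_colouring_def split: if_splits)
    then have even: "even i"
      using i by presburger
    have "\<exists>j<n. odd j \<and> (j = (i + 1) mod n \<or> j = (i + (n - 1)) mod n)"
    proof (cases "i + 1 < n")
      case True
      then show ?thesis
        using even by (intro exI[of _ "i + 1"]) simp
    next
      case False
      then have "i = (n - 2) + 1" "n = (n - 2) + 2"
        using i(2) assms by simp_all
      then obtain j where j: "i = j + 1" "n = j + 2"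
        by blast
      have "(i + (n - 1)) mod n = (j + n) mod n"
        using j by simp
      also have "\<dots> = j"
        using j(2) by (simp only: mod_add_self2) simp
      finally show ?thesis
        using even j by (intro exI[of _ j]) simp
    qed
    then obtain j where j: "odd j" "j = (i + 1) mod n \<or> j = (i + (n - 1)) mod n"
      by blast
    have "2 * i mod 4 = 0" "(2 * j + 1) mod 4 = 3"
      using even j(1) by presburger+
    moreover have "2 * i \<in> open_nbhd ?G v" "2 * j + 1 \<in> open_nbhd ?G v"
      unfolding i(1) open_nbhd_prism(2)[OF n i(2)] using j(2) by blast+
    ultimately show ?thesis
      by metis
  qed
  then obtain x y where "x \<in> open_nbhd ?G v" "?c x = {1}" "y \<in> open_nbhd ?G v" "?c y = {2}"
    by (auto simp: alternating_colouring_def)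
  moreover have "?c u \<subseteq> {1, 2}" for u
    by (auto simp: alternating_colouring_def)
  ultimately show "(\<Union>u \<in> open_nbhd ?G v. ?c u) = {1, 2}"
    by blast
qed

lemma alternating_colouring_weight:
  "rainbow2_weight (gen_petersen n 1) alternating_colouring = n"
proof -
  have "card (alternating_colouring (2 * i)) + card (alternating_colouring (2 * i + 1)) = 1" for i
  proof (cases "even i")
    case True
    then have "2 * i mod 4 = 0" "(2 * i + 1) mod 4 = 1"
      by presburger+
    then show ?thesis
      by (simp add: alternating_colouring_def)
  next
    case False
    then have "2 * i mod 4 = 2" "(2 * i + 1) mod 4 = 3"
      by presburger+
    then show ?thesis
      by (simp add: alternating_colouring_def)
  qed
  then show ?thesis
    by (simp add: rainbow2_weight_def sum_columns)
qed

theorem mainTheorem4: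
  fixes n :: nat
  assumes "n \<ge> 3"
  shows "italian_domination_number (gen_petersen n 1) = rainbow2_domination_number (gen_petersen n 1)"
proof (rule antisym)
  let ?G = "gen_petersen n 1"
  have "finite (open_nbhd ?G v)" if "v \<in> pverts ?G" for v
    using gen_petersen_3_regular[OF assms _ _ that] assms by (auto intro: card_ge_0_finite)
  then show "italian_domination_number ?G \<le> rainbow2_domination_number ?G"
    by (rule italian_le_rainbow2_domination_number)
  obtain f where f: "italian_dominating ?G f" "italian_weight ?G f = italian_domination_number ?G"
    using italian_domination_number_attained by blast
  have "rainbow2_domination_number ?G \<le> n"
    using rainbow2_domination_number_le[OF alternating_colouring_dominating[of n]] assms
    by (simp only: alternating_colouring_weight)
  also have "n \<le> italian_domination_number ?G"
    using italian_weight_prism_ge[OF _ f(1)] f(2) assms by simp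
  finally show "rainbow2_domination_number ?G \<le> italian_domination_number ?G" .
qed

end
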